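(* Let $d\geq 1$ and let $A$ be an integral symmetric matrix of size $d\times d$. For every natural integer $N\geq 1$, the convex hull $\mathrm{Conv}(\mathcal L_A(N))\subset\mathbb R^d$ is a polytope whose set of integral elements (points of $\mathbb Z^d$) is contained in $$\bigcup_{k=N}^\infty \mathcal L_A(k)$$ and whose set of vertices is exactly $\mathcal L_A(N)$.
   Context: For an integral symmetric $d\times d$ matrix $A$ and a natural integer $N\geq 1$, $\mathcal L_A(N)$ denotes the set of all integral diagonal $d\times d$ matrices $D$ such that $A+D$ is positive definite and $\det(A+D)=N$. Diagonal $d\times d$ matrices are identified with vectors of $\mathbb R^d$ (the vector of diagonal entries), so that $\mathcal L_A(N)\subset\mathbb Z^d\subset\mathbb R^d$. $\mathrm{Conv}$ denotes the convex hull. A polytope is the convex hull of a finite set of points. *)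

theory Defs
  imports "HOL-Analysis.Analysis"
begin

definition diag :: "'a::zero ^ 'n \<Rightarrow> 'a ^ 'n ^ 'n" where
  "diag v = (\<chi> i j. if i = j then v $ i else 0)"

definition real_vec :: "int ^ 'n \<Rightarrow> real ^ 'n" where
  "real_vec v = (\<chi> i. of_int (v $ i))"

definition real_mat :: "int ^ 'n ^ 'm \<Rightarrow> real ^ 'n ^ 'm" where
  "real_mat M = (\<chi> i j. of_int (M $ i $ j))"

definition positive_definite :: "real ^ 'n ^ 'n \<Rightarrow> bool" where
  "positive_definite M \<longleftrightarrow>
     transpose M = M \<and> (\<forall>x. x \<noteq> 0 \<longrightarrow> 0 < x \<bullet> (M *v x))"

(* An integral diagonal matrix D = diag v is represented by its diagonal v,
   and the resulting subset of Z^d is viewed inside R^d. *)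
definition diag_completions :: "int ^ 'n ^ 'n \<Rightarrow> nat \<Rightarrow> (real ^ 'n) set" where
  "diag_completions A N =
     real_vec ` {v. positive_definite (real_mat (A + diag v)) \<and> det (A + diag v) = int N}"

end

theory Submission
  imports Defs
begin

text \<open>
  Everything rests on a supporting hyperplane: the positive definite \<open>M\<close> with \<open>det M \<ge> det M0\<close>
  all lie on one side of the tangent hyperplane at \<open>M0\<close>. Concretely, if \<open>M\<close> is positive
  definite, \<open>M \<noteq> M0\<close> and \<open>tr (M0\<^sup>-\<^sup>1 M) \<le> tr (M0\<^sup>-\<^sup>1 M0) = d\<close>, then \<open>det M < det M0\<close>. After a
  congruence that turns \<open>M0\<close> into the identity this says that a positive definite matrix of trace
  at most \<open>d\<close>, other than the identity, has determinant below 1. That follows from Hadamard's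
  inequality (the determinant is at most the product of the diagonal entries), whose proof by
  symmetric Gauss elimination is \<open>congruent_diagonal_bounded\<close>, and from the inequality of
  arithmetic and geometric means. The result is \<open>det_supporting_functional\<close>.

  Restricted to \<open>M = B + diag v\<close> the trace is, up to a constant, a linear form \<open>w \<bullet> v\<close>, and its
  coefficients are nonnegative (\<open>det_add_diag_supporting_vector\<close>). Hence, with \<open>L\<close> the set of
  completions of determinant \<open>N\<close>:

  \<^item> \<open>L\<close> is finite. If \<open>u \<le> v\<close> coordinatewise then \<open>w \<bullet> u \<le> w \<bullet> v\<close>, so two comparable elements of \<open>L\<close>,
  having the same determinant, coincide. The diagonal of \<open>A + diag v\<close> is positive, so \<open>L\<close> is
  bounded below, and Dickson's lemma says that such an antichain of integer vectors is finite.

  \<^item> Every \<open>a\<close> in \<open>L\<close> is a vertex. The form \<open>w\<close> that belongs to \<open>a\<close> is strictly larger on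
  \<open>L - {a}\<close> than at \<open>a\<close>, so \<open>a\<close> is not in the convex hull of the other points.

  \<^item> Every \<open>x\<close> in the hull has determinant at least \<open>N\<close>. Positive definiteness is a convex
  condition, so \<open>x\<close> has a form \<open>w\<close> of its own. Some \<open>v\<close> in \<open>L\<close> satisfies \<open>w \<bullet> v \<le> w \<bullet> x\<close>, and
  so the determinant at \<open>x\<close> is not below the one at \<open>v\<close>.
\<close>

section \<open>Diagonalizing a positive definite matrix by congruences\<close>

lemma positive_definite_transpose: "positive_definite M \<Longrightarrow> transpose M = M"
  by (simp add: positive_definite_def)

lemma positive_definite_sym: "positive_definite M \<Longrightarrow> M $ i $ j = M $ j $ i"
  using arg_cong[OF positive_definite_transpose, of M "\<lambda>X. X $ i $ j"]
  by (simp add: transpose_def)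

lemma positive_definite_diagonal_pos:
  assumes "positive_definite M"
  shows "0 < M $ i $ i"
proof -
  have "0 < axis i 1 \<bullet> (M *v axis i 1)"
    using assms by (simp add: positive_definite_def axis_eq_0_iff)
  then show ?thesis
    by (simp add: matrix_vector_mult_basis inner_axis' column_def)
qed

lemma positive_definite_congruence:
  fixes M C :: "real ^ 'n ^ 'n"
  assumes "positive_definite M" and "det C \<noteq> 0"
  shows "positive_definite (transpose C ** M ** C)"
  unfolding positive_definite_def
proof (intro conjI allI impI)
  show "transpose (transpose C ** M ** C) = transpose C ** M ** C"
    by (simp add: matrix_transpose_mul positive_definite_transpose[OF assms(1)] matrix_mul_assoc)
next
  fix x :: "real ^ 'n"
  assume "x \<noteq> 0"
  then have "C *v x \<noteq> 0"
    by (metis assms(2) invertible_det_nz invertible_left_inverse matrix_left_invertible_ker)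
  moreover have "x \<bullet> (transpose C ** M ** C *v x) = (C *v x) \<bullet> (M *v (C *v x))"
    by (metis dot_lmul_matrix matrix_vector_mul_assoc transpose_transpose vector_transpose_matrix)
  ultimately show "0 < x \<bullet> (transpose C ** M ** C *v x)"
    using assms(1) by (simp add: positive_definite_def)
qed

text \<open>One step of symmetric Gauss elimination. Completing the square clears row and column
  \<open>i\<close> outside the pivot and leaves the Schur complement, whose diagonal entries are those of \<open>S\<close>
  minus multiples of squares.\<close>

lemma symmetric_elimination:
  fixes S :: "real ^ 'n ^ 'n"
  assumes sym: "\<And>a b. S $ a $ b = S $ b $ a" and piv: "S $ i $ i \<noteq> 0"
  obtains C :: "real ^ 'n ^ 'n" where "det C = 1"
    and "\<And>j k. (transpose C ** S ** C) $ j $ k =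
      (if j = i \<and> k = i then S $ i $ i
       else if j = i \<or> k = i then 0
       else S $ j $ k - S $ i $ j * S $ i $ k / S $ i $ i)"
proof -
  define c where "c b = (if b = i then 0 else S $ i $ b / S $ i $ i)" for b
  define C :: "real ^ 'n ^ 'n"
    where "C = (\<chi> a b. (if a = b then 1 else 0) - (if a = i then c b else 0))"
  (* C arises from the identity by adding x, a combination of the other rows, to row i. *)
  define x :: "real ^ 'n" where "x = (\<chi> b. - c b)"
  have "x = (\<Sum>b\<in>-{i}. - c b *s axis b 1)"
    by (simp add: x_def c_def vec_eq_iff axis_def if_distrib[of "\<lambda>z. _ * z"] sum_negf
        cong: if_cong)
  also have "\<dots> \<in> vec.span {row j (mat 1 :: real ^ 'n ^ 'n) |j. j \<noteq> i}"
  proof (intro vec.span_sum vec.span_scale vec.span_base)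
    fix b assume "b \<in> -{i}"
    moreover have "axis b 1 = row b (mat 1 :: real ^ 'n ^ 'n)"
      by (simp add: row_def mat_def axis_def vec_eq_iff)
    ultimately show "axis b 1 \<in> {row j (mat 1 :: real ^ 'n ^ 'n) |j. j \<noteq> i}"
      by auto
  qed
  finally have "det (\<chi> k. if k = i then row i (mat 1) + x else row k (mat 1)) = det (mat 1 :: real ^ 'n ^ 'n)"
    by (rule det_row_span)
  moreover have "(\<chi> k. if k = i then row i (mat 1) + x else row k (mat 1)) = C"
    by (simp add: vec_eq_iff C_def row_def mat_def x_def)
  ultimately have det: "det C = 1"
    by simp
  have SC: "(S ** C) $ a $ k = S $ a $ k - c k * S $ a $ i" for a k
    by (simp add: matrix_matrix_mult_def C_def right_diff_distrib sum_subtractf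
        if_distrib[of "\<lambda>z. _ * z"] cong: if_cong)
  have CX: "(transpose C ** X) $ j $ k = X $ j $ k - c j * X $ i $ k" for X :: "real ^ 'n ^ 'n" and j k
    by (simp add: matrix_matrix_mult_def transpose_def C_def
        left_diff_distrib sum_subtractf if_distrib[of "\<lambda>z. z * _"] cong: if_cong)
  have entry: "(transpose C ** S ** C) $ j $ k =
      S $ j $ k - c k * S $ j $ i - c j * (S $ i $ k - c k * S $ i $ i)" for j k
    by (simp add: matrix_mul_assoc[symmetric] CX SC)
  show thesis
  proof (rule that[OF det])
    fix j k
    show "(transpose C ** S ** C) $ j $ k =
      (if j = i \<and> k = i then S $ i $ i
       else if j = i \<or> k = i then 0
       else S $ j $ k - S $ i $ j * S $ i $ k / S $ i $ i)"
      using piv sym[of j i] by (simp add: entry c_def)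
  qed
qed

text \<open>Hadamard's inequality, with its equality case, in a form that does not mention
  determinants. Eliminating one index after the other only lowers diagonal entries, and an
  entry stays the same only if the off-diagonal entry being cleared was already zero. Since
  \<open>C\<close> has determinant 1, the determinant of \<open>S\<close> is the product of the entries of \<open>D\<close>.\<close>

lemma congruent_diagonal_bounded:
  fixes S :: "real ^ 'n ^ 'n"
  assumes "positive_definite S"
  obtains C D :: "real ^ 'n ^ 'n" where "det C = 1" and "D = transpose C ** S ** C"
    and "\<And>a b. a \<noteq> b \<Longrightarrow> D $ a $ b = 0" and "\<And>a. D $ a $ a \<le> S $ a $ a"
    and "(\<And>a. D $ a $ a = S $ a $ a) \<Longrightarrow> D = S"
proof -
  (* I is the set of indices whose rows may still have entries off the diagonal. *)
  have "\<exists>C D :: real ^ 'n ^ 'n. det C = 1 \<and> D = transpose C ** S ** C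
      \<and> (\<forall>a b. a \<noteq> b \<longrightarrow> D $ a $ b = 0) \<and> (\<forall>a. D $ a $ a \<le> S $ a $ a)
      \<and> ((\<forall>a. D $ a $ a = S $ a $ a) \<longrightarrow> D = S)"
    if "finite I" and "positive_definite S" and "\<forall>a b. a \<notin> I \<longrightarrow> a \<noteq> b \<longrightarrow> S $ a $ b = 0" for I S
    using that
  proof (induction I arbitrary: S rule: finite_induct)
    case empty
    then show ?case
      by (intro exI[of _ "mat 1"] exI[of _ S]) (simp add: transpose_mat)
  next
    case (insert i I)
    note sym = positive_definite_sym[OF insert.prems(1)]
    have piv: "0 < S $ i $ i"
      by (rule positive_definite_diagonal_pos[OF insert.prems(1)])
    then obtain C1 where detC1: "det C1 = 1"
      and E: "\<And>j k. (transpose C1 ** S ** C1) $ j $ k =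
      (if j = i \<and> k = i then S $ i $ i
       else if j = i \<or> k = i then 0
       else S $ j $ k - S $ i $ j * S $ i $ k / S $ i $ i)"
      using symmetric_elimination[of S i] sym by (metis less_irrefl)
    define T where "T = transpose C1 ** S ** C1"
    have pdT: "positive_definite T"
      unfolding T_def by (rule positive_definite_congruence) (use insert.prems detC1 in auto)
    have offdiag: "\<forall>a b. a \<notin> I \<longrightarrow> a \<noteq> b \<longrightarrow> T $ a $ b = 0"
    proof (intro allI impI)
      fix a b assume "a \<notin> I" "a \<noteq> b"
      then have "a = i \<or> S $ a $ b = 0 \<and> S $ i $ a = 0"
        using insert.prems(2) sym[of i a] by auto
      with \<open>a \<noteq> b\<close> show "T $ a $ b = 0"
        by (auto simp: T_def E)
    qed
    from insert.IH[OF pdT offdiag] obtain C2 D where IH: "det C2 = 1" "D = transpose C2 ** T ** C2"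
      "\<forall>a b. a \<noteq> b \<longrightarrow> D $ a $ b = 0" "\<forall>a. D $ a $ a \<le> T $ a $ a"
      "(\<forall>a. D $ a $ a = T $ a $ a) \<longrightarrow> D = T"
      by (elim exE conjE) (rule that; assumption)
    have Tle: "T $ a $ a \<le> S $ a $ a" for a
      using piv by (simp add: T_def E)
    have "D = S" if eq: "\<forall>a. D $ a $ a = S $ a $ a"
    proof -
      have TS: "T $ a $ a = S $ a $ a" for a
        using eq IH(4) Tle[of a] by (metis order_antisym)
      then have "D = T"
        using IH(5) eq by simp
      have "S $ i $ a = 0" if "a \<noteq> i" for a
        using TS[of a] that piv by (simp add: T_def E)
      then have "T $ a $ b = S $ a $ b" for a b
        using sym[of a i] by (auto simp: T_def E)
      with \<open>D = T\<close> show ?thesis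
        by (simp add: vec_eq_iff)
    qed
    moreover have "D = transpose (C1 ** C2) ** S ** (C1 ** C2)"
      by (simp add: IH(2) T_def matrix_transpose_mul matrix_mul_assoc)
    moreover have "D $ a $ a \<le> S $ a $ a" for a
      using IH(4) Tle[of a] order_trans by blast
    moreover have "det (C1 ** C2) = 1"
      by (simp add: IH(1) detC1 det_mul)
    ultimately show ?case
      using IH(3) by (intro exI[of _ "C1 ** C2"] exI[of _ D] conjI allI impI) simp_all
  qed
  from this[of UNIV S] obtain C D where "det C = 1" "D = transpose C ** S ** C"
      "\<forall>a b. a \<noteq> b \<longrightarrow> D $ a $ b = 0" "\<forall>a. D $ a $ a \<le> S $ a $ a"
      "(\<forall>a. D $ a $ a = S $ a $ a) \<longrightarrow> D = S"
    using assms by auto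
  then show thesis
    by (intro that[of C D]) simp_all
qed

section \<open>A supporting functional of the determinant\<close>

text \<open>The inequality of arithmetic and geometric means at mean 1, in its strict form: it is
  the sum of the tangent inequalities \<open>ln y \<le> y - 1\<close>, which are equalities only at 1.\<close>

lemma prod_less_one_if_sum_le_card:
  fixes y :: "'a \<Rightarrow> real"
  assumes "finite I" and pos: "\<And>i. i \<in> I \<Longrightarrow> 0 < y i" and "sum y I \<le> card I"
    and "k \<in> I" "y k \<noteq> 1"
  shows "prod y I < 1"
proof -
  have "ln (prod y I) = (\<Sum>i\<in>I. ln (y i))"
    using assms by (intro ln_prod) fastforce+
  also have "\<dots> < (\<Sum>i\<in>I. y i - 1)"
  proof (rule sum_strict_mono_ex1)
    show "\<forall>i\<in>I. ln (y i) \<le> y i - 1"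
      using pos ln_le_minus_one by blast
    show "\<exists>i\<in>I. ln (y i) < y i - 1"
    proof
      have "ln (y k) \<le> y k - 1" and "ln (y k) \<noteq> y k - 1"
        using ln_le_minus_one ln_eq_minus_one pos \<open>k \<in> I\<close> \<open>y k \<noteq> 1\<close> by blast+
      then show "ln (y k) < y k - 1"
        by simp
    qed fact
  qed fact
  also have "\<dots> \<le> 0"
    using assms by (simp add: sum_subtractf)
  finally show ?thesis
    using prod_pos[of I y] pos by simp
qed

text \<open>If \<open>C\<close> diagonalizes \<open>M0\<close> and \<open>p k\<close> is the inverse of the \<open>k\<close>-th diagonal entry obtained,
  the functional below is \<open>tr (M0\<^sup>-\<^sup>1 M)\<close>, that is, up to a positive factor the derivative of the
  determinant at \<open>M0\<close>. Its value at \<open>M0\<close> is the dimension. Written as a positive combination of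
  diagonal entries of congruent matrices, it is visibly monotone in \<open>M\<close>.\<close>

lemma det_supporting_functional:
  fixes M0 :: "real ^ 'n ^ 'n"
  assumes "positive_definite M0"
  obtains C :: "real ^ 'n ^ 'n" and p :: "'n \<Rightarrow> real" where "\<And>k. 0 < p k"
    and "\<And>M. \<lbrakk>positive_definite M; M \<noteq> M0;
        (\<Sum>k\<in>UNIV. p k * (transpose C ** M ** C) $ k $ k)
          \<le> (\<Sum>k\<in>UNIV. p k * (transpose C ** M0 ** C) $ k $ k)\<rbrakk> \<Longrightarrow> det M < det M0"
proof -
  obtain C D0 where C: "det C = 1" and D0: "D0 = transpose C ** M0 ** C"
    and diag0: "\<And>a b. a \<noteq> b \<Longrightarrow> D0 $ a $ b = 0"
    using congruent_diagonal_bounded[OF assms] by metis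
  have D0_pos: "0 < D0 $ k $ k" for k
    unfolding D0
    by (intro positive_definite_diagonal_pos positive_definite_congruence assms) (simp add: C)
  then have D0_nz: "D0 $ k $ k \<noteq> 0" for k
    by (metis less_irrefl)
  have detM0: "det M0 = (\<Prod>k\<in>UNIV. D0 $ k $ k)"
    using det_diagonal[of D0] diag0 by (simp add: D0 det_mul C)
  show thesis
  proof (rule that[of "\<lambda>k. 1 / D0 $ k $ k" C])
    fix M :: "real ^ 'n ^ 'n"
    assume M: "positive_definite M" "M \<noteq> M0"
      and le: "(\<Sum>k\<in>UNIV. 1 / D0 $ k $ k * (transpose C ** M ** C) $ k $ k)
        \<le> (\<Sum>k\<in>UNIV. 1 / D0 $ k $ k * (transpose C ** M0 ** C) $ k $ k)"
    (* The congruence by C makes M0 diagonal but not M; a second one diagonalizes the image of M.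
       The quotients y k of the diagonal entries then multiply to det M / det M0. *)
    define S where "S = transpose C ** M ** C"
    have pdS: "positive_definite S"
      unfolding S_def by (intro positive_definite_congruence M) (simp add: C)
    obtain C' D where C': "det C' = 1" and D: "D = transpose C' ** S ** C'"
      and diag: "\<And>a b. a \<noteq> b \<Longrightarrow> D $ a $ b = 0"
      and DS: "\<And>a. D $ a $ a \<le> S $ a $ a"
      and DS_eq: "(\<And>a. D $ a $ a = S $ a $ a) \<Longrightarrow> D = S"
      using congruent_diagonal_bounded[OF pdS] by metis
    have D_pos: "0 < D $ k $ k" for k
      unfolding D
      by (intro positive_definite_diagonal_pos positive_definite_congruence pdS) (simp add: C')
    have detM: "det M = (\<Prod>k\<in>UNIV. D $ k $ k)"
      using det_diagonal[of D] diag by (simp add: D S_def det_mul C C')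
    define y where "y k = D $ k $ k / D0 $ k $ k" for k
    have y_pos: "0 < y k" for k
      using D_pos D0_pos by (simp add: y_def)
    have y_le: "y k \<le> S $ k $ k / D0 $ k $ k" for k
      using DS[of k] D0_pos[of k] by (simp add: y_def divide_right_mono)
    have trace: "(\<Sum>k\<in>UNIV. S $ k $ k / D0 $ k $ k) \<le> CARD('n)"
      using le by (simp add: S_def[symmetric] D0[symmetric] D0_nz)
    (* If all y k are 1, the trace bound leaves no slack in Hadamard's inequality. *)
    have "\<exists>k. y k \<noteq> 1"
    proof (rule ccontr)
      assume "\<nexists>k. y k \<noteq> 1"
      then have y1: "y k = 1" for k
        by simp
      have "(\<Sum>k\<in>UNIV. y k) = (\<Sum>k\<in>UNIV. S $ k $ k / D0 $ k $ k)"
        using trace sum_mono[of UNIV y "\<lambda>k. S $ k $ k / D0 $ k $ k"] y_le y1 by auto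
      then have "y k = S $ k $ k / D0 $ k $ k" for k
        by (rule sum_mono_inv) (auto intro: y_le)
      then have "D $ k $ k = S $ k $ k" for k
        using D0_nz[of k] by (metis y_def divide_cancel_right)
      then have "D = S"
        by (rule DS_eq)
      moreover have "D = D0"
      proof -
        have "D $ a $ b = D0 $ a $ b" for a b
          using y1[of a] D0_nz[of a] diag diag0 by (cases "a = b") (auto simp: y_def)
        then show ?thesis
          by (simp add: vec_eq_iff)
      qed
      ultimately have eq: "transpose C ** M ** C = transpose C ** M0 ** C"
        by (simp add: S_def D0)
      obtain B where B: "C ** B = mat 1"
        using C invertible_det_nz[of C] unfolding invertible_def by auto
      then have "transpose B ** transpose C = mat 1"
        by (metis matrix_transpose_mul transpose_mat)
      then have "X = transpose B ** (transpose C ** X ** C) ** B" for X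
        by (metis B matrix_mul_assoc matrix_mul_lid matrix_mul_rid)
      with eq have "M = M0"
        by metis
      with M show False
        by simp
    qed
    then obtain k where "y k \<noteq> 1" ..
    moreover have "sum y UNIV \<le> CARD('n)"
      using sum_mono[of UNIV y "\<lambda>k. S $ k $ k / D0 $ k $ k"] y_le trace by fastforce
    ultimately have "prod y UNIV < 1"
      using y_pos by (intro prod_less_one_if_sum_le_card) auto
    moreover have "det M = prod y UNIV * det M0"
      by (simp add: detM detM0 y_def prod.distrib[symmetric] D0_nz)
    moreover have "0 < det M0"
      by (simp add: detM0 D0_pos prod_pos)
    ultimately show "det M < det M0"
      by simp
  qed (simp add: D0_pos)
qed

text \<open>On the diagonal translates of \<open>B\<close> the functional is affine in \<open>v\<close>, with linear part \<open>w\<close>.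
  The signs of the coefficients give monotonicity of the determinant, the bound itself gives
  strict convexity of its superlevel sets.\<close>

lemma det_add_diag_supporting_vector:
  fixes B :: "real ^ 'n ^ 'n" and v0 :: "real ^ 'n"
  assumes "positive_definite (B + diag v0)"
  obtains w :: "real ^ 'n" where "\<And>i. 0 \<le> w $ i"
    and "\<And>v. \<lbrakk>positive_definite (B + diag v); v \<noteq> v0; w \<bullet> v \<le> w \<bullet> v0\<rbrakk>
        \<Longrightarrow> det (B + diag v) < det (B + diag v0)"
proof (rule det_supporting_functional[OF assms])
  fix C :: "real ^ 'n ^ 'n" and p :: "'n \<Rightarrow> real"
  assume p: "\<And>k. 0 < p k"
    and less: "\<And>M. \<lbrakk>positive_definite M; M \<noteq> B + diag v0;
        (\<Sum>k\<in>UNIV. p k * (transpose C ** M ** C) $ k $ k)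
          \<le> (\<Sum>k\<in>UNIV. p k * (transpose C ** (B + diag v0) ** C) $ k $ k)\<rbrakk>
        \<Longrightarrow> det M < det (B + diag v0)"
  define w :: "real ^ 'n" where "w = (\<chi> i. \<Sum>k\<in>UNIV. p k * (C $ i $ k)\<^sup>2)"
  have diagC: "(diag v ** C) $ i $ k = v $ i * C $ i $ k" for v :: "real ^ 'n" and i k
    by (simp add: matrix_matrix_mult_def diag_def if_distrib[of "\<lambda>z. z * _"] cong: if_cong)
  have CX: "(transpose C ** X) $ j $ k = (\<Sum>i\<in>UNIV. C $ i $ j * X $ i $ k)" for X :: "real ^ 'n ^ 'n" and j k
    by (simp add: matrix_matrix_mult_def transpose_def)
  have add_mult: "(X + Y) ** C = X ** C + Y ** C" for X Y :: "real ^ 'n ^ 'n"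
    by (simp add: matrix_matrix_mult_def vec_eq_iff distrib_right sum.distrib)
  have functional: "(\<Sum>k\<in>UNIV. p k * (transpose C ** (B + diag v) ** C) $ k $ k)
      = (\<Sum>k\<in>UNIV. p k * (transpose C ** B ** C) $ k $ k) + w \<bullet> v" for v
  proof -
    have "(transpose C ** diag v ** C) $ k $ k = (\<Sum>i\<in>UNIV. (C $ i $ k)\<^sup>2 * v $ i)" for k
      by (simp add: matrix_mul_assoc[symmetric] CX diagC power2_eq_square ac_simps)
    then have "(\<Sum>k\<in>UNIV. p k * (transpose C ** (B + diag v) ** C) $ k $ k)
      = (\<Sum>k\<in>UNIV. p k * (transpose C ** B ** C) $ k $ k)
        + (\<Sum>k\<in>UNIV. \<Sum>i\<in>UNIV. p k * (C $ i $ k)\<^sup>2 * v $ i)"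
      by (simp add: matrix_mul_assoc[symmetric] add_mult matrix_add_ldistrib distrib_left sum.distrib
          sum_distrib_left mult.assoc)
    also have "(\<Sum>k\<in>UNIV. \<Sum>i\<in>UNIV. p k * (C $ i $ k)\<^sup>2 * v $ i) = w \<bullet> v"
      by (subst sum.swap) (simp add: w_def inner_vec_def sum_distrib_right)
    finally show ?thesis .
  qed
  show thesis
  proof (rule that[of w])
    show "0 \<le> w $ i" for i
      using p by (auto simp: w_def less_imp_le intro!: sum_nonneg)
    fix v assume v: "positive_definite (B + diag v)" "v \<noteq> v0" "w \<bullet> v \<le> w \<bullet> v0"
    have "diag v \<noteq> diag v0"
      using v(2) by (auto simp: diag_def vec_eq_iff)
    then show "det (B + diag v) < det (B + diag v0)"
      using v by (intro less) (auto simp: functional)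
  qed
qed

text \<open>For each fixed \<open>x\<close> the quadratic form at \<open>x\<close> is affine in \<open>v\<close>, so the set is an
  intersection of open half-spaces (and of a symmetry condition on \<open>B\<close> alone).\<close>

lemma convex_positive_definite_add_diag:
  fixes B :: "real ^ 'n ^ 'n"
  shows "convex {v. positive_definite (B + diag v)}"
proof -
  have sym: "transpose (B + diag v) = B + diag v \<longleftrightarrow> transpose B = B" for v
    by (auto simp: transpose_def diag_def vec_eq_iff) metis+
  have form: "x \<bullet> ((B + diag v) *v x) = x \<bullet> (B *v x) + (\<chi> i. (x $ i)\<^sup>2) \<bullet> v"
    for x v :: "real ^ 'n"
  proof -
    have "diag v *v x = (\<chi> i. v $ i * x $ i)"
      by (simp add: matrix_vector_mult_def diag_def vec_eq_iff if_distrib[of "\<lambda>z. z * _"] cong: if_cong)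
    then have "x \<bullet> (diag v *v x) = (\<chi> i. (x $ i)\<^sup>2) \<bullet> v"
      by (simp add: inner_vec_def power2_eq_square ac_simps)
    then show ?thesis
      by (simp add: matrix_vector_mult_add_rdistrib inner_add_right)
  qed
  have "{v. positive_definite (B + diag v)} = {v. transpose B = B} \<inter>
      (\<Inter>x\<in>-{0}. {v. (\<chi> i. (x $ i)\<^sup>2) \<bullet> v > - (x \<bullet> (B *v x))})"
    by (force simp: positive_definite_def sym form)
  moreover have "convex {v :: real ^ 'n. transpose B = B}"
    by (cases "transpose B = B") auto
  ultimately show ?thesis
    by (auto intro!: convex_Int convex_INT convex_halfspace_gt)
qed

section \<open>Integral completions of given determinant\<close>

text \<open>A monotone subsequence exists in any linear order; if it decreases, it is eventually
  constant because the natural numbers are well-ordered.\<close>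

lemma nat_seq_incseq_subseq:
  fixes s :: "nat \<Rightarrow> nat"
  obtains r where "strict_mono r" and "incseq (\<lambda>n. s (r n))"
proof -
  obtain f where f: "strict_mono f" and "monoseq (\<lambda>n. s (f n))"
    using seq_monosub by blast
  then consider "incseq (\<lambda>n. s (f n))" | "decseq (\<lambda>n. s (f n))"
    by (auto simp: monoseq_iff)
  then show thesis
  proof cases
    case 1
    with f show thesis by (rule that)
  next
    case 2
    obtain K where K: "\<And>n. s (f K) \<le> s (f n)"
      using ex_has_least_nat[of "\<lambda>_. True" _ "\<lambda>n. s (f n)"] by blast
    have "s (f (n + K)) = s (f K)" for n
      using K[of "n + K"] 2 by (simp add: decseq_def order_antisym)
    then have "incseq (\<lambda>n. s (f (n + K)))"
      by (simp add: incseq_def)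
    moreover have "strict_mono (\<lambda>n. f (n + K))"
      using f by (simp add: strict_mono_def)
    ultimately show thesis
      using that[of "\<lambda>n. f (n + K)"] by simp
  qed
qed

lemma dickson_subseq:
  fixes f :: "nat \<Rightarrow> 'i \<Rightarrow> nat"
  assumes "finite I"
  shows "\<exists>r. strict_mono r \<and> (\<forall>i\<in>I. incseq (\<lambda>n. f (r n) i))"
  using assms
proof (induction I rule: finite_induct)
  case empty
  show ?case
    by (intro exI[of _ id]) (simp add: strict_mono_def)
next
  case (insert i I)
  then obtain r where r: "strict_mono r" "\<And>j. j \<in> I \<Longrightarrow> incseq (\<lambda>n. f (r n) j)"
    by blast
  obtain q where q: "strict_mono q" "incseq (\<lambda>n. f (r (q n)) i)"
    using nat_seq_incseq_subseq[of "\<lambda>n. f (r n) i"] by blast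
  have "incseq (\<lambda>n. f (r (q n)) j)" if "j \<in> I" for j
    using r(2)[OF that] strict_mono_mono[OF q(1)] by (simp add: mono_def)
  then show ?case
    using q r(1) by (intro exI[of _ "\<lambda>n. r (q n)"]) (auto simp: strict_mono_def)
qed

text \<open>Dickson's lemma: an infinite set bounded below contains a sequence of distinct vectors
  that increases in every coordinate, and hence two comparable elements.\<close>

lemma finite_antichain_bounded_below:
  fixes L :: "(int ^ 'n) set"
  assumes bound: "\<And>v i. v \<in> L \<Longrightarrow> b i \<le> v $ i"
    and antichain: "\<And>u v. \<lbrakk>u \<in> L; v \<in> L; \<And>i. u $ i \<le> v $ i\<rbrakk> \<Longrightarrow> u = v"
  shows "finite L"
proof (rule ccontr)
  assume "infinite L"
  then obtain g :: "nat \<Rightarrow> int ^ 'n" where g: "inj g" "range g \<subseteq> L"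
    using infinite_countable_subset by blast
  obtain r where r: "strict_mono r" "\<And>i. incseq (\<lambda>n. nat (g (r n) $ i - b i))"
    using dickson_subseq[of UNIV "\<lambda>n i. nat (g n $ i - b i)"] by auto
  have "g (r 0) $ i \<le> g (r 1) $ i" for i
    using incseqD[OF r(2)[of i], of 0 1] bound[of "g (r 0)" i] bound[of "g (r 1)" i] g(2) by (auto simp: image_subset_iff)
  then have "g (r 0) = g (r 1)"
    using g(2) by (intro antichain) auto
  then have "r 0 = r 1"
    using g(1) by (simp add: inj_eq)
  then show False
    using r(1) by (simp add: strict_mono_eq)
qed

lemma det_real_mat: "det (real_mat M) = real_of_int (det M)"
  by (simp add: det_def real_mat_def)

lemma real_mat_add_diag: "real_mat (A + diag v) = real_mat A + diag (real_vec v)"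
  by (simp add: real_mat_def diag_def real_vec_def vec_eq_iff)

text \<open>Membership phrased with real vectors only, so that the convexity results apply
  directly.\<close>

lemma mem_diag_completions_iff:
  "x \<in> diag_completions A N \<longleftrightarrow>
     (\<forall>i. x $ i \<in> \<int>) \<and> positive_definite (real_mat A + diag x) \<and> det (real_mat A + diag x) = real N"
  (is "?L \<longleftrightarrow> ?R")
proof
  assume ?L
  then obtain v where v: "x = real_vec v" "positive_definite (real_mat (A + diag v))"
      "det (A + diag v) = int N"
    by (auto simp: diag_completions_def)
  then have "det (real_mat (A + diag v)) = real N"
    by (simp add: det_real_mat)
  with v show ?R
    by (auto simp: real_mat_add_diag real_vec_def)
next
  assume R: ?R
  then have "x = real_vec (\<chi> i. \<lfloor>x $ i\<rfloor>)"
    by (simp add: real_vec_def vec_eq_iff)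
  then obtain v where v: "x = real_vec v" ..
  with R have "real_of_int (det (A + diag v)) = real N"
    by (metis det_real_mat real_mat_add_diag)
  then have "det (A + diag v) = int N"
    by linarith
  with R v show ?L
    by (auto simp: diag_completions_def real_mat_add_diag)
qed

lemma finite_diag_completions: "finite (diag_completions A N)"
proof -
  let ?L = "{v. positive_definite (real_mat (A + diag v)) \<and> det (A + diag v) = int N}"
  have "finite ?L"
  proof (rule finite_antichain_bounded_below)
    fix v i assume "v \<in> ?L"
    then have "0 < real_mat (A + diag v) $ i $ i"
      by (intro positive_definite_diagonal_pos) simp
    then show "- (A $ i $ i) \<le> v $ i"
      by (simp add: real_mat_def diag_def)
  next
    fix u v assume u: "u \<in> ?L" and v: "v \<in> ?L" and le: "\<And>i. u $ i \<le> v $ i"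
    from v have pd: "positive_definite (real_mat A + diag (real_vec v))"
      by (simp add: real_mat_add_diag)
    obtain w where w: "\<And>i. 0 \<le> w $ i"
      and less: "\<And>x. \<lbrakk>positive_definite (real_mat A + diag x); x \<noteq> real_vec v; w \<bullet> x \<le> w \<bullet> real_vec v\<rbrakk>
        \<Longrightarrow> det (real_mat A + diag x) < det (real_mat A + diag (real_vec v))"
      by (rule det_add_diag_supporting_vector[OF pd]) (rule that; blast)
    have "w \<bullet> real_vec u \<le> w \<bullet> real_vec v"
      using w le by (auto simp: inner_vec_def real_vec_def intro!: sum_mono mult_left_mono)
    moreover have "det (real_mat A + diag (real_vec u)) = det (real_mat A + diag (real_vec v))"
      using u v by (simp add: real_mat_add_diag[symmetric] det_real_mat)
    ultimately have "real_vec u = real_vec v"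
      using less[of "real_vec u"] u by (auto simp: real_mat_add_diag)
    then show "u = v"
      by (simp add: real_vec_def vec_eq_iff)
  qed
  then show ?thesis
    by (simp add: diag_completions_def)
qed

lemma diag_completions_convex_independent:
  assumes "a \<in> diag_completions A N"
  shows "a \<notin> convex hull (diag_completions A N - {a})"
proof -
  have pd: "positive_definite (real_mat A + diag a)"
    using assms by (simp add: mem_diag_completions_iff)
  obtain w where "\<And>i. 0 \<le> w $ i" and less: "\<And>x. \<lbrakk>positive_definite (real_mat A + diag x); x \<noteq> a; w \<bullet> x \<le> w \<bullet> a\<rbrakk>
      \<Longrightarrow> det (real_mat A + diag x) < det (real_mat A + diag a)"
    by (rule det_add_diag_supporting_vector[OF pd]) (rule that; blast)
  have "diag_completions A N - {a} \<subseteq> {x. w \<bullet> x > w \<bullet> a}"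
    using less assms by (force simp: mem_diag_completions_iff)
  then have "convex hull (diag_completions A N - {a}) \<subseteq> {x. w \<bullet> x > w \<bullet> a}"
    by (intro hull_minimal convex_halfspace_gt)
  then show ?thesis
    by auto
qed

lemma det_ge_on_hull_diag_completions:
  assumes x: "x \<in> convex hull (diag_completions A N)"
  shows "positive_definite (real_mat A + diag x)" and "real N \<le> det (real_mat A + diag x)"
proof -
  have "convex hull (diag_completions A N) \<subseteq> {v. positive_definite (real_mat A + diag v)}"
    by (intro hull_minimal convex_positive_definite_add_diag) (auto simp: mem_diag_completions_iff)
  with x show pd: "positive_definite (real_mat A + diag x)"
    by auto
  obtain w where "\<And>i. 0 \<le> w $ i" and less: "\<And>v. \<lbrakk>positive_definite (real_mat A + diag v); v \<noteq> x; w \<bullet> v \<le> w \<bullet> x\<rbrakk>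
      \<Longrightarrow> det (real_mat A + diag v) < det (real_mat A + diag x)"
    by (rule det_add_diag_supporting_vector[OF pd]) (rule that; blast)
  have "\<exists>v\<in>diag_completions A N. w \<bullet> v \<le> w \<bullet> x"
  proof (rule ccontr)
    assume "\<not> ?thesis"
    then have "diag_completions A N \<subseteq> {v. w \<bullet> v > w \<bullet> x}"
      by auto
    then have "convex hull (diag_completions A N) \<subseteq> {v. w \<bullet> v > w \<bullet> x}"
      by (intro hull_minimal convex_halfspace_gt)
    with x show False
      by auto
  qed
  then show "real N \<le> det (real_mat A + diag x)"
    using less by (force simp: mem_diag_completions_iff)
qed

theorem theorem7p1:
  fixes A :: "int ^ 'n ^ 'n" and N :: nat
  assumes "transpose A = A" and "N \<ge> 1"
  shows "polytope (convex hull (diag_completions A N))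
    \<and> {x \<in> convex hull (diag_completions A N). \<forall>i. x $ i \<in> \<int>} \<subseteq> (\<Union>k\<in>{N..}. diag_completions A k)
    \<and> {x. x extreme_point_of (convex hull (diag_completions A N))} = diag_completions A N"
proof (intro conjI subsetI)
  show "polytope (convex hull (diag_completions A N))"
    by (intro polytope_convex_hull finite_diag_completions)
  show "{x. x extreme_point_of (convex hull (diag_completions A N))} = diag_completions A N"
    using extreme_point_of_convex_hull_convex_independent[OF finite_imp_compact[OF finite_diag_completions]
        diag_completions_convex_independent] by blast
next
  fix x assume x: "x \<in> {x \<in> convex hull (diag_completions A N). \<forall>i. x $ i \<in> \<int>}"
  then have pd: "positive_definite (real_mat A + diag x)"
    and ge: "real N \<le> det (real_mat A + diag x)"
    using det_ge_on_hull_diag_completions by auto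
  have "x = real_vec (\<chi> i. \<lfloor>x $ i\<rfloor>)"
    using x by (simp add: real_vec_def vec_eq_iff)
  then have det: "det (real_mat A + diag x) = real_of_int (det (A + diag (\<chi> i. \<lfloor>x $ i\<rfloor>)))"
    by (metis det_real_mat real_mat_add_diag)
  define k where "k = nat (det (A + diag (\<chi> i. \<lfloor>x $ i\<rfloor>)))"
  have "real k = det (real_mat A + diag x)"
    using ge det by (simp add: k_def)
  moreover from this have "N \<le> k"
    using ge by simp
  ultimately have "x \<in> diag_completions A k"
    using x pd by (simp add: mem_diag_completions_iff)
  with \<open>N \<le> k\<close> show "x \<in> (\<Union>k\<in>{N..}. diag_completions A k)"
    by auto
qed

end
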